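(* For a Tychonoff space $X$, the following assertions are equivalent: (i) $X$ is a $k_{\mathbb{R}}$-space; (ii) $X$ is strongly functionally generated by the family $\mathcal{K}(X)$ of all compact subsets of $X$; (iii) $X$ is functionally generated by the family $\mathcal{K}(X)$; (iv) $X$ is strongly functionally generated by a family of $k_{\mathbb{R}}$-subspaces of $X$ (that is, by some cover of $X$ consisting of subspaces which are $k_{\mathbb{R}}$-spaces); (v) $X$ is an $R$-quotient image of some topological sum of compact spaces; (vi) $X$ is an $R$-quotient image of a locally compact space; (vii) $X$ is an $R$-quotient image of a $k$-space; (viii) $X$ is an $R$-quotient image of a $k_{\mathbb{R}}$-space.
   Context: All spaces are assumed to be Tychonoff (completely regular Hausdorff). A function $f:X\to\mathbb{R}$ is $k$-continuous if its restriction to every compact subset of $X$ is continuous. A space $X$ is a $k_{\mathbb{R}}$-space if every $k$-continuous function $f:X\to\mathbb{R}$ is continuous. A space $X$ is a $k$-space if for each non-closed $A\subseteq X$ there is a compact $K\subseteq X$ such that $A\cap K$ is not closed in $K$. Let $\mathcal{M}$ be a cover of $X$ by subsets of $X$. $X$ is strongly functionally generated by $\mathcal{M}$ if for each discontinuous function $f:X\to\mathbb{R}$ there is $M\in\mathcal{M}$ such that $f|_M:M\to\mathbb{R}$ is discontinuous. $X$ is functionally generated by $\mathcal{M}$ if for every discontinuous $f:X\to\mathbb{R}$ there is $M\in\mathcal{M}$ such that $f|_M$ cannot be extended to a real-valued continuous function on the whole space $X$. A map $p:Y\to X$ is $R$-quotient if it is continuous, onto, and every function $\phi:X\to\mathbb{R}$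 is continuous whenever $\phi\circ p$ is continuous; then $X$ is called an $R$-quotient image of $Y$. *)

theory Defs
  imports "HOL-Analysis.Analysis"
begin

(* A function on the space X is a total function on the carrier type of X;
   continuous_map only looks at its values on topspace X. *)

definition tychonoff_space :: "'a topology \<Rightarrow> bool" where
  "tychonoff_space X \<longleftrightarrow> completely_regular_space X \<and> Hausdorff_space X"

definition k_continuous :: "'a topology \<Rightarrow> ('a \<Rightarrow> real) \<Rightarrow> bool" where
  "k_continuous X f \<longleftrightarrow>
     (\<forall>K. compactin X K \<longrightarrow> continuous_map (subtopology X K) euclideanreal f)"

definition kR_space :: "'a topology \<Rightarrow> bool" where
  "kR_space X \<longleftrightarrow>
     (\<forall>f. k_continuous X f \<longrightarrow> continuous_map X euclideanreal f)"

definition cover_of :: "'a topology \<Rightarrow> 'a set set \<Rightarrow> bool" where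
  "cover_of X \<M> \<longleftrightarrow> \<Union>\<M> = topspace X"

definition strongly_functionally_generated :: "'a topology \<Rightarrow> 'a set set \<Rightarrow> bool" where
  "strongly_functionally_generated X \<M> \<longleftrightarrow>
     cover_of X \<M> \<and>
     (\<forall>f. \<not> continuous_map X euclideanreal f \<longrightarrow>
        (\<exists>M\<in>\<M>. \<not> continuous_map (subtopology X M) euclideanreal f))"

definition functionally_generated :: "'a topology \<Rightarrow> 'a set set \<Rightarrow> bool" where
  "functionally_generated X \<M> \<longleftrightarrow>
     cover_of X \<M> \<and>
     (\<forall>f. \<not> continuous_map X euclideanreal f \<longrightarrow>
        (\<exists>M\<in>\<M>. \<not> (\<exists>g. continuous_map X euclideanreal g \<and> (\<forall>x\<in>M. g x = f x))))"

definition R_quotient_map :: "'b topology \<Rightarrow> 'a topology \<Rightarrow> ('b \<Rightarrow> 'a) \<Rightarrow> bool" where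
  "R_quotient_map Y X p \<longleftrightarrow>
     continuous_map Y X p \<and> p ` topspace Y = topspace X \<and>
     (\<forall>\<phi>. continuous_map Y euclideanreal (\<phi> \<circ> p) \<longrightarrow> continuous_map X euclideanreal \<phi>)"

definition R_quotient_image :: "'a topology \<Rightarrow> 'b topology \<Rightarrow> bool" where
  "R_quotient_image X Y \<longleftrightarrow> (\<exists>p. R_quotient_map Y X p)"

(* "X is an R-quotient image of a space with property P" quantifies over spaces of arbitrary
   size, which is not possible inside one HOL formula. The two predicates below restrict the
   space, respectively the summands and their index set, to the types given by the "itself"
   arguments; the unrestricted notion is their disjunction over all types. All spaces involved
   are Tychonoff. *)

definition R_quotient_image_of_some ::
    "'b itself \<Rightarrow> ('b topology \<Rightarrow> bool) \<Rightarrow> 'a topology \<Rightarrow> bool" where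
  "R_quotient_image_of_some T P X \<longleftrightarrow>
     (\<exists>Y :: 'b topology. tychonoff_space Y \<and> P Y \<and> R_quotient_image X Y)"

definition R_quotient_image_of_compact_sum ::
    "'i itself \<Rightarrow> 'b itself \<Rightarrow> 'a topology \<Rightarrow> bool" where
  "R_quotient_image_of_compact_sum TI TB X \<longleftrightarrow>
     (\<exists>(I :: 'i set) (C :: 'i \<Rightarrow> 'b topology).
        (\<forall>i\<in>I. tychonoff_space (C i) \<and> compact_space (C i)) \<and>
        R_quotient_image X (sum_topology C I))"

end

(* The sum of the compact subspaces of X maps onto X, and a function on X is k-continuous exactly
   when its composition with this map is continuous; so X is a k_R-space iff the map is R-quotient.
   Being a k_R-space passes to R-quotient images because the image of a compact set is compact.
   Functional and strong functional generation by the compact sets agree because a continuous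
   real function on a compact subset of a completely regular space extends to the whole space. *)
theory Submission
  imports Defs
begin

lemma k_space_imp_kR_space: "k_space X \<Longrightarrow> kR_space X"
  unfolding kR_space_def k_continuous_def using continuous_map_from_k_space by metis

text \<open>Such a sum is locally compact, hence a k-space.\<close>

lemma compact_sum_imp_kR_space:
  assumes "\<And>i. i \<in> I \<Longrightarrow> compact_space (C i)"
  shows "kR_space (sum_topology C I)"
  using assms
  by (simp add: k_space_imp_kR_space locally_compact_imp_k_space locally_compact_space_sum_topology
      compact_imp_locally_compact_space)

text \<open>On a compact \<open>K\<close> the composition factors through the image of
  \<open>K\<close>, which is compact in \<open>X\<close>. With \<open>p\<close> the inclusion of a
  subspace, this shows that k-continuity passes to restrictions.\<close>

lemma k_continuous_compose:
  assumes "k_continuous X f" "continuous_map Y X p"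
  shows "k_continuous Y (f \<circ> p)"
  unfolding k_continuous_def
proof (intro allI impI)
  fix K assume K: "compactin Y K"
  have "compactin X (p ` K)"
    using K assms(2) by (rule image_compactin)
  then have "continuous_map (subtopology X (p ` K)) euclideanreal f"
    using assms(1) by (simp add: k_continuous_def)
  moreover have "continuous_map (subtopology Y K) (subtopology X (p ` K)) p"
    using assms(2) by (auto simp: continuous_map_in_subtopology continuous_map_from_subtopology)
  ultimately show "continuous_map (subtopology Y K) euclideanreal (f \<circ> p)"
    by (rule continuous_map_compose[rotated])
qed

text \<open>A k-continuous function on \<open>X\<close> pulls back to a k-continuous, hence
  continuous, function on \<open>Y\<close>, and the R-quotient map reflects continuity.\<close>

lemma kR_space_R_quotient_image:
  assumes "kR_space Y" "R_quotient_image X Y"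
  shows "kR_space X"
  using assms k_continuous_compose
  unfolding kR_space_def R_quotient_image_def R_quotient_map_def by metis

text \<open>Singletons are compact. This settles the covering clause in both notions of generation
  and the surjectivity of the map from the sum.\<close>

lemma Union_compactin: "\<Union>{K. compactin X K} = topspace X"
proof
  show "\<Union>{K. compactin X K} \<subseteq> topspace X"
    by (intro Union_least) (simp add: compactin_subset_topspace)
  show "topspace X \<subseteq> \<Union>{K. compactin X K}"
  proof
    fix x assume "x \<in> topspace X"
    then show "x \<in> \<Union>{K. compactin X K}"
      by (intro UnionI[of "{x}"]) simp_all
  qed
qed

lemma kR_space_iff_strongly_functionally_generated:
  "kR_space X \<longleftrightarrow> strongly_functionally_generated X {K. compactin X K}"
  by (auto simp: kR_space_def k_continuous_def strongly_functionally_generated_def cover_of_def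
      Union_compactin)

lemma functionally_generated_compact_iff_strongly:
  assumes "completely_regular_space X"
  shows "functionally_generated X {K. compactin X K} \<longleftrightarrow>
         strongly_functionally_generated X {K. compactin X K}"
proof -
  \<comment> \<open>The equivalence holds for each compact \<open>K\<close> and each
    \<open>f\<close> separately, so the two definitions agree clause by clause.\<close>
  have "(\<exists>g. continuous_map X euclideanreal g \<and> (\<forall>x\<in>K. g x = f x)) \<longleftrightarrow>
        continuous_map (subtopology X K) euclideanreal f" (is "?L \<longleftrightarrow> ?R")
    if K: "compactin X K" for K and f :: "'a \<Rightarrow> real"
  proof
    assume ?L
    then obtain g where g: "continuous_map X euclideanreal g" "\<And>x. x \<in> K \<Longrightarrow> g x = f x"
      by blast
    show ?R
      by (rule continuous_map_eq[OF continuous_map_from_subtopology[OF g(1)]]) (simp add: g(2))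
  next
    assume R: ?R
    show ?L
      \<comment> \<open>The target interval is the whole line, which makes the condition on the
        values of \<open>f\<close> trivial.\<close>
      by (rule Tietze_extension_completely_regular[OF assms K is_interval_univ _ R]) auto
  qed
  then show ?thesis
    by (simp add: functionally_generated_def strongly_functionally_generated_def)
qed

text \<open>A k-continuous function restricts to a k-continuous, hence continuous, function on each
  member of the family, and generation makes it continuous on \<open>X\<close>.\<close>

lemma strongly_functionally_generated_by_kR_imp_kR_space:
  assumes kR: "\<And>M. M \<in> \<M> \<Longrightarrow> kR_space (subtopology X M)"
    and gen: "strongly_functionally_generated X \<M>"
  shows "kR_space X"
  unfolding kR_space_def
proof (intro allI impI)
  fix f assume f: "k_continuous X f"
  have "continuous_map (subtopology X M) euclideanreal f" if "M \<in> \<M>" for M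
    using kR[OF that] k_continuous_compose[OF f continuous_map_from_subtopology[OF continuous_map_id]]
    by (simp add: kR_space_def)
  with gen show "continuous_map X euclideanreal f"
    unfolding strongly_functionally_generated_def by blast
qed

text \<open>Used to see that the sum of the compact subspaces is Tychonoff. Points of one summand
  are separated inside it, points of different summands by the summands themselves.\<close>

lemma Hausdorff_space_sum_topology:
  assumes "\<And>i. i \<in> I \<Longrightarrow> Hausdorff_space (X i)"
  shows "Hausdorff_space (sum_topology X I)"
  unfolding Hausdorff_space_def
proof (simp only: split_paired_All, intro allI impI, elim conjE)
  fix i x j y
  assume ix: "(i, x) \<in> topspace (sum_topology X I)" and jy: "(j, y) \<in> topspace (sum_topology X I)"
    and ne: "(i, x) \<noteq> (j, y)"
  have ope: "openin (sum_topology X I) (Pair k ` U)" if "k \<in> I" "openin (X k) U" for k U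
    using open_map_component_injection that unfolding open_map_def by metis
  \<comment> \<open>For distinct indices the images under \<open>Pair i\<close> and
    \<open>Pair j\<close> are disjoint anyway, so disjointness is asked only when
    \<open>i = j\<close>.\<close>
  obtain U V where "openin (X i) U" "openin (X j) V" "x \<in> U" "y \<in> V" "i = j \<Longrightarrow> disjnt U V"
  proof (cases "i = j")
    case True
    with assms[of i] ix jy ne that show ?thesis
      unfolding Hausdorff_space_def by auto
  next
    case False
    with ix jy that[of "topspace (X i)" "topspace (X j)"] show ?thesis
      by auto
  qed
  then show "\<exists>U V. openin (sum_topology X I) U \<and> openin (sum_topology X I) V \<and>
               (i, x) \<in> U \<and> (j, y) \<in> V \<and> disjnt U V"
    using ix jy ope[of i U] ope[of j V]
    by (intro exI[of _ "Pair i ` U"] exI[of _ "Pair j ` V"]) (auto simp: disjnt_iff)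
qed

text \<open>Each compact set is its own index, and \<open>snd\<close> combines all the inclusions
  into one map.\<close>

lemma kR_space_imp_R_quotient_map_compact_sum:
  assumes "kR_space X"
  shows "R_quotient_map (sum_topology (subtopology X) {K. compactin X K}) X snd"
  unfolding R_quotient_map_def
proof (intro conjI allI impI)
  let ?S = "sum_topology (subtopology X) {K. compactin X K}"
  show "continuous_map ?S X snd"
    unfolding continuous_map_def
  proof (intro conjI allI impI)
    show "snd \<in> topspace ?S \<rightarrow> topspace X"
      by auto
    fix U assume U: "openin X U"
    \<comment> \<open>The preimage of \<open>U\<close> meets the summand \<open>K\<close> in
      \<open>K \<inter> U\<close>, which is open in \<open>K\<close>.\<close>
    have "{z \<in> topspace ?S. snd z \<in> U} = Sigma {K. compactin X K} (\<lambda>K. K \<inter> U)"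
      using openin_subset[OF U] by auto
    then show "openin ?S {z \<in> topspace ?S. snd z \<in> U}"
      using U by (simp add: openin_disjoint_union openin_subtopology_Int2)
  qed
  show "snd ` topspace ?S = topspace X"
    using Union_compactin[of X] by (auto simp: snd_image_Sigma)
  fix \<phi> :: "'a \<Rightarrow> real" assume \<phi>: "continuous_map ?S euclideanreal (\<phi> \<circ> snd)"
  have "continuous_map (subtopology X K) euclideanreal \<phi>" if "compactin X K" for K
  proof -
    \<comment> \<open>Preceding \<open>\<phi> \<circ> snd\<close> by the injection of the summand
      \<open>K\<close> gives back \<open>\<phi>\<close> on \<open>K\<close>.\<close>
    have "continuous_map (subtopology X K) ?S (Pair K)"
      using that by (intro continuous_map_component_injection) simp
    from continuous_map_compose[OF this \<phi>] show ?thesis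
      by (simp add: comp_def)
  qed
  with assms show "continuous_map X euclideanreal \<phi>"
    by (simp add: kR_space_def k_continuous_def)
qed

lemma tychonoff_space_subtopology:
  "tychonoff_space X \<Longrightarrow> tychonoff_space (subtopology X S)"
  by (simp add: tychonoff_space_def completely_regular_space_subtopology Hausdorff_space_subtopology)

lemma R_quotient_image_of_compact_sum_imp_kR_space:
  "R_quotient_image_of_compact_sum TI TB X \<Longrightarrow> kR_space X"
  unfolding R_quotient_image_of_compact_sum_def
  using compact_sum_imp_kR_space kR_space_R_quotient_image by metis

lemma R_quotient_image_of_some_imp_kR_space:
  assumes "R_quotient_image_of_some T P X" "\<And>Y. P Y \<Longrightarrow> kR_space Y"
  shows "kR_space X"
  using assms kR_space_R_quotient_image unfolding R_quotient_image_of_some_def by metis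

lemma kR_space_imp_R_quotient_image_of_compact_sum:
  fixes X :: "'a topology"
  assumes "tychonoff_space X" "kR_space X"
  shows "R_quotient_image_of_compact_sum TYPE('a set) TYPE('a) X"
  unfolding R_quotient_image_of_compact_sum_def R_quotient_image_def
  using assms kR_space_imp_R_quotient_map_compact_sum
  by (intro exI[of _ "{K. compactin X K}"] exI[of _ "subtopology X"])
     (auto simp: tychonoff_space_subtopology compact_space_subtopology)

lemma kR_space_imp_R_quotient_image_of_locally_compact:
  fixes X :: "'a topology"
  assumes "tychonoff_space X" "kR_space X"
  shows "R_quotient_image_of_some TYPE('a set \<times> 'a) locally_compact_space X"
proof -
  let ?S = "sum_topology (subtopology X) {K. compactin X K}"
  have lc: "locally_compact_space ?S"
    by (simp add: compact_imp_locally_compact_space compact_space_subtopology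
        locally_compact_space_sum_topology)
  have "Hausdorff_space ?S"
    using assms(1)
    by (simp add: tychonoff_space_def Hausdorff_space_sum_topology Hausdorff_space_subtopology)
  \<comment> \<open>Complete regularity of the sum follows from local compactness and the Hausdorff
    property, without gluing functions from the summands.\<close>
  with lc have "tychonoff_space ?S"
    by (simp add: tychonoff_space_def locally_compact_regular_imp_completely_regular_space)
  with lc show ?thesis
    using kR_space_imp_R_quotient_map_compact_sum[OF assms(2)]
    unfolding R_quotient_image_of_some_def R_quotient_image_def by blast
qed

lemma R_quotient_image_of_some_mono:
  assumes "R_quotient_image_of_some T P X" "\<And>Y. P Y \<Longrightarrow> Q Y"
  shows "R_quotient_image_of_some T Q X"
  using assms unfolding R_quotient_image_of_some_def by blast

theorem theorem6p1:
  fixes X :: "'a topology"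
  assumes "tychonoff_space X"
  shows
    "(kR_space X \<longleftrightarrow> strongly_functionally_generated X {K. compactin X K}) \<and>
     (kR_space X \<longleftrightarrow> functionally_generated X {K. compactin X K}) \<and>
     (kR_space X \<longleftrightarrow> (\<exists>\<M>. (\<forall>M\<in>\<M>. kR_space (subtopology X M)) \<and>
                            strongly_functionally_generated X \<M>)) \<and>
     (kR_space X \<longleftrightarrow> R_quotient_image_of_compact_sum TYPE('a set) TYPE('a) X) \<and>
     (kR_space X \<longleftrightarrow> R_quotient_image_of_some TYPE('a set \<times> 'a) locally_compact_space X) \<and>
     (kR_space X \<longleftrightarrow> R_quotient_image_of_some TYPE('a set \<times> 'a) k_space X) \<and>
     (kR_space X \<longleftrightarrow> R_quotient_image_of_some TYPE('a set \<times> 'a) kR_space X) \<and>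
     (R_quotient_image_of_compact_sum TYPE('i) TYPE('b) X \<longrightarrow> kR_space X) \<and>
     (R_quotient_image_of_some TYPE('c) locally_compact_space X \<longrightarrow> kR_space X) \<and>
     (R_quotient_image_of_some TYPE('c) k_space X \<longrightarrow> kR_space X) \<and>
     (R_quotient_image_of_some TYPE('c) kR_space X \<longrightarrow> kR_space X)"
proof -
  note lc = kR_space_imp_R_quotient_image_of_locally_compact[OF assms]
  \<comment> \<open>The same locally compact sum also serves as witness for the larger classes of
    k-spaces and k_R-spaces.\<close>
  note k = R_quotient_image_of_some_mono[OF lc locally_compact_imp_k_space]
  note kR = R_quotient_image_of_some_mono[OF k k_space_imp_kR_space]
  \<comment> \<open>These converses leave the carrier type of the covering space open, so they apply
    both to the type of the concrete sum and to the arbitrary type \<open>'c\<close>.\<close>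
  note lcD = R_quotient_image_of_some_imp_kR_space[where P = locally_compact_space,
      OF _ k_space_imp_kR_space[OF locally_compact_imp_k_space]]
  note kD = R_quotient_image_of_some_imp_kR_space[where P = k_space, OF _ k_space_imp_kR_space]
  note kRD = R_quotient_image_of_some_imp_kR_space[where P = kR_space]
  note sfg = kR_space_iff_strongly_functionally_generated
  have fg: "kR_space X \<longleftrightarrow> functionally_generated X {K. compactin X K}"
    using assms sfg functionally_generated_compact_iff_strongly tychonoff_space_def by blast
  \<comment> \<open>Compact subspaces are themselves k_R-spaces, so the family of all compact sets
    is a witness for generation by k_R-subspaces.\<close>
  have "kR_space (subtopology X K)" if "compactin X K" for K
    by (simp add: that compact_imp_k_space compact_space_subtopology k_space_imp_kR_space)
  then have iv: "kR_space X \<longleftrightarrow> (\<exists>\<M>. (\<forall>M\<in>\<M>. kR_space (subtopology X M)) \<and>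
                               strongly_functionally_generated X \<M>)"
    using sfg strongly_functionally_generated_by_kR_imp_kR_space by (metis mem_Collect_eq)
  show ?thesis
    by (intro conjI impI sfg fg iv iffI;
        (erule lcD kD | erule kRD, assumption | erule lc k kR
        | erule kR_space_imp_R_quotient_image_of_compact_sum[OF assms]
        | erule R_quotient_image_of_compact_sum_imp_kR_space))
qed

end
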